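(* Let $(G,d)$ be a $p$-uniformly convex space, let $D\subset G$, and let $T:G\to G$ with $\operatorname{Fix}T\cap D$ nonempty and $T(D)\subseteq D$. Suppose further that $T$ is pointwise $\alpha$-firmly nonexpansive at all $y\in\operatorname{Fix}T\cap D$ on $D$. Then given any starting point $x_0\in D$ the sequence $(x_k)_{k\in\mathbb N}$ defined by $x_{k+1}=Tx_k$ is asymptotically regular, i.e. $\lim_{k\to\infty}d(x_k,x_{k+1})=0$.
   Context: Let $p\in(1,\infty)$. A metric space $(G,d)$ is $p$-uniformly convex with constant $c>0$ if it is a geodesic space and for all $x,y,z\in G$, $t\in[0,1]$: $$d(z,(1-t)x\oplus ty)^p\le(1-t)d(z,x)^p+td(z,y)^p-\tfrac c2t(1-t)d(x,y)^p,$$ where $(1-t)x\oplus ty$ is the point on the (unique) geodesic joining $x$ and $y$ at distance $t\,d(x,y)$ from $x$. $\operatorname{Fix}T=\{x:Tx=x\}$. $\psi_T^{(p,c)}(x,y)=\tfrac c2\left(d(Tx,x)^p+d(Ty,y)^p+d(Tx,Ty)^p+d(x,y)^p-d(Tx,y)^p-d(x,Ty)^p\right)$. $T$ is pointwise $\alpha$-firmly nonexpansive at $y\in D$ on $D$ if there is $\alpha\in(0,1)$ with $d(Tx,Ty)^p\le d(x,y)^p-\tfrac{1-\alpha}{\alpha}\psi_T^{(p,c)}(x,y)$ for all $x\in D$. *)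

theory Defs
  imports "HOL-Analysis.Analysis"
begin

definition geodesic_on :: "'a set \<Rightarrow> ('a \<Rightarrow> 'a \<Rightarrow> real) \<Rightarrow> (real \<Rightarrow> 'a) \<Rightarrow> 'a \<Rightarrow> 'a \<Rightarrow> bool" where
  "geodesic_on G d \<gamma> x y \<longleftrightarrow>
     \<gamma> ` {0..1} \<subseteq> G \<and> \<gamma> 0 = x \<and> \<gamma> 1 = y \<and>
     (\<forall>s\<in>{0..1}. \<forall>t\<in>{0..1}. d (\<gamma> s) (\<gamma> t) = \<bar>s - t\<bar> * d x y)"

definition geodesic_space :: "'a set \<Rightarrow> ('a \<Rightarrow> 'a \<Rightarrow> real) \<Rightarrow> bool" where
  "geodesic_space G d \<longleftrightarrow>
     Metric_space G d \<and> (\<forall>x\<in>G. \<forall>y\<in>G. \<exists>\<gamma>. geodesic_on G d \<gamma> x y)"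

text \<open>If \<open>\<gamma>\<close> is a geodesic from \<open>x\<close> to \<open>y\<close>, then \<open>\<gamma> t\<close> is its point at distance
  \<open>t * d x y\<close> from \<open>x\<close>, that is \<open>(1 - t) x \<oplus> t y\<close>. The inequality is
  required along every geodesic from \<open>x\<close> to \<open>y\<close>; that this point does not depend on the choice
  of \<open>\<gamma>\<close> then follows (lemma \<open>p_uniformly_convex_geodesic_unique\<close>).\<close>

definition p_uniformly_convex :: "'a set \<Rightarrow> ('a \<Rightarrow> 'a \<Rightarrow> real) \<Rightarrow> real \<Rightarrow> real \<Rightarrow> bool" where
  "p_uniformly_convex G d p c \<longleftrightarrow>
     0 < c \<and> geodesic_space G d \<and>
     (\<forall>x\<in>G. \<forall>y\<in>G. \<forall>z\<in>G. \<forall>\<gamma>. \<forall>t\<in>{0..1}. geodesic_on G d \<gamma> x y \<longrightarrow>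
        d z (\<gamma> t) powr p
          \<le> (1 - t) * d z x powr p + t * d z y powr p - c / 2 * t * (1 - t) * d x y powr p)"

lemma p_uniformly_convex_geodesic_unique:
  assumes "p_uniformly_convex G d p c" "1 < p" "x \<in> G" "y \<in> G"
    and g: "geodesic_on G d \<gamma> x y" and g': "geodesic_on G d \<gamma>' x y" and t: "t \<in> {0..1}"
  shows "\<gamma> t = \<gamma>' t"
proof (rule ccontr)
  assume ne: "\<gamma> t \<noteq> \<gamma>' t"
  have c: "0 < c" and geo: "geodesic_space G d"
    using assms(1) unfolding p_uniformly_convex_def by blast+
  interpret Metric_space G d
    using geo unfolding geodesic_space_def by blast
  have inG: "\<gamma> t \<in> G" "\<gamma>' t \<in> G"
    using g g' t unfolding geodesic_on_def by blast+
  then obtain \<sigma> where s: "geodesic_on G d \<sigma> (\<gamma> t) (\<gamma>' t)"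
    using geo unfolding geodesic_space_def by blast
  define m where "m = \<sigma> (1/2)"
  have "(1/2 :: real) \<in> {0..1}" by simp
  then have mG: "m \<in> G" using s unfolding geodesic_on_def m_def by blast
  have pos: "0 < d (\<gamma> t) (\<gamma>' t)" using ne inG by simp
  have closer: "d z m < r" if "z \<in> G" "d z (\<gamma> t) = r" "d z (\<gamma>' t) = r" for z r
  proof -
    have "d z (\<sigma> (1/2)) powr p \<le> (1 - 1/2) * d z (\<gamma> t) powr p + 1/2 * d z (\<gamma>' t) powr p
        - c / 2 * (1/2) * (1 - 1/2) * d (\<gamma> t) (\<gamma>' t) powr p"
    proof -
      have "\<forall>x\<in>G. \<forall>y\<in>G. \<forall>z\<in>G. \<forall>\<gamma>. \<forall>t\<in>{0..1}. geodesic_on G d \<gamma> x y \<longrightarrow>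
        d z (\<gamma> t) powr p
          \<le> (1 - t) * d z x powr p + t * d z y powr p - c / 2 * t * (1 - t) * d x y powr p"
        using assms(1) unfolding p_uniformly_convex_def by (elim conjE)
      from this[THEN bspec, OF inG(1), THEN bspec, OF inG(2), THEN bspec, OF that(1),
          THEN spec, of \<sigma>, THEN bspec, of "1/2"] s
      show ?thesis by simp
    qed
    then have le: "d z m powr p \<le> r powr p - c / 8 * d (\<gamma> t) (\<gamma>' t) powr p"
      using that by (simp add: m_def)
    have "0 < c / 8 * d (\<gamma> t) (\<gamma>' t) powr p" using c pos by simp
    with le have "d z m powr p < r powr p" by linarith
    moreover have "0 \<le> r" using that(2) nonneg by metis
    ultimately show ?thesis
      using \<open>1 < p\<close> powr_mono2[of p r "d z m"] by (cases "d z m < r") auto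
  qed
  have from_ends: "d x (\<delta> t) = t * d x y \<and> d y (\<delta> t) = (1 - t) * d x y"
    if \<delta>: "geodesic_on G d \<delta> x y" for \<delta>
  proof -
    have \<delta>0: "\<delta> 0 = x \<and> \<delta> 1 = y" using \<delta> unfolding geodesic_on_def by blast
    have "d (\<delta> s) (\<delta> t) = \<bar>s - t\<bar> * d x y" if "s \<in> {0..1}" for s
      using \<delta> t that unfolding geodesic_on_def by blast
    from this[of 0] this[of 1] show ?thesis
      using \<delta>0 t by simp
  qed
  have "d x m < t * d x y" "d y m < (1 - t) * d x y"
    using closer assms(3,4) from_ends[OF g] from_ends[OF g'] by simp_all
  moreover have "d x y \<le> d x m + d y m"
    using triangle[of x m y] assms(3,4) mG by (simp add: commute)
  ultimately show False by (simp add: algebra_simps)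
qed

definition Fix :: "'a set \<Rightarrow> ('a \<Rightarrow> 'a) \<Rightarrow> 'a set" where
  "Fix G T = {x \<in> G. T x = x}"

definition psi :: "('a \<Rightarrow> 'a \<Rightarrow> real) \<Rightarrow> real \<Rightarrow> real \<Rightarrow> ('a \<Rightarrow> 'a) \<Rightarrow> 'a \<Rightarrow> 'a \<Rightarrow> real" where
  "psi d p c T x y =
     c / 2 * (d (T x) x powr p + d (T y) y powr p + d (T x) (T y) powr p + d x y powr p
              - d (T x) y powr p - d x (T y) powr p)"

text \<open>The constant \<open>\<alpha>\<close> is bound inside the definition, so it may depend on the point \<open>y\<close>.\<close>

definition pointwise_firmly_nonexpansive ::
    "('a \<Rightarrow> 'a \<Rightarrow> real) \<Rightarrow> real \<Rightarrow> real \<Rightarrow> ('a \<Rightarrow> 'a) \<Rightarrow> 'a set \<Rightarrow> 'a \<Rightarrow> bool" where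
  "pointwise_firmly_nonexpansive d p c T D y \<longleftrightarrow>
     y \<in> D \<and>
     (\<exists>\<alpha>. 0 < \<alpha> \<and> \<alpha> < 1 \<and>
        (\<forall>x\<in>D. d (T x) (T y) powr p \<le> d x y powr p - (1 - \<alpha>) / \<alpha> * psi d p c T x y))"

end

theory Submission
  imports Defs
begin

text \<open>At a fixed point \<open>y\<close> the transport discrepancy collapses to
  \<open>psi d p c T x y = c / 2 * d (T x) x powr p\<close>, so firm nonexpansiveness makes
  \<open>d (x k) y powr p\<close> decrease by at least a fixed multiple of
  \<open>d (x k) (x (Suc k)) powr p\<close> in each step. A nonnegative decreasing sequence converges,
  hence its decrements tend to \<open>0\<close>.\<close>

lemma psi_fixed_point:
  assumes "Metric_space G d" "y \<in> G" "T y = y"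
  shows "psi d p c T x y = c / 2 * d (T x) x powr p"
proof -
  have "d y y = 0"
    using Metric_space.zero[OF assms(1,2,2)] by simp
  \<comment> \<open>With \<open>T y = y\<close> the two negative terms cancel the third and fourth;
    the second vanishes because \<open>0 powr p = 0\<close>.\<close>
  then show ?thesis
    by (simp add: psi_def assms(3))
qed

lemma tendsto_zero_if_bounded_by_decrement:
  fixes a b :: "nat \<Rightarrow> real"
  assumes "0 < K" "\<And>k. 0 \<le> a k" "\<And>k. 0 \<le> b k" "\<And>k. K * b k \<le> a k - a (Suc k)"
  shows "b \<longlonglongrightarrow> 0"
proof -
  have "a (Suc k) \<le> a k" for k
    using mult_nonneg_nonneg[OF less_imp_le[OF assms(1)] assms(3)[of k]] assms(4)[of k] by linarith
  then have "decseq a"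
    by (simp add: decseq_Suc_iff)
  then have "convergent a"
    by (intro Bseq_monoseq_convergent decseq_bounded[OF _ allI[OF assms(2)]] decseq_imp_monoseq)
  then obtain L where L: "a \<longlonglongrightarrow> L"
    by (auto simp: convergent_def)
  \<comment> \<open>These quotients squeeze \<open>b\<close> from above; they tend to 0 because
    \<open>a\<close> and its shift share the limit \<open>L\<close>.\<close>
  have "(\<lambda>k. (a k - a (Suc k)) / K) \<longlonglongrightarrow> (L - L) / K"
    using assms(1) by (intro tendsto_intros L LIMSEQ_Suc[OF L]) simp
  then have "(\<lambda>k. (a k - a (Suc k)) / K) \<longlonglongrightarrow> 0"
    by simp
  moreover have "norm (b k) \<le> (a k - a (Suc k)) / K" for k
    using assms(1,3,4) by (simp add: pos_le_divide_eq mult.commute)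
  ultimately show ?thesis
    by (rule Lim_null_comparison[OF always_eventually[OF allI], rotated])
qed

text \<open>Taking p-th roots is continuous at 0 on the nonnegative reals. Since the limit of the
  base is 0, \<open>tendsto_powr\<close> does not apply; \<open>tendsto_powr2\<close> asks instead
  for an eventually nonnegative base and a positive limit exponent, here
  \<open>1 / p\<close>.\<close>

lemma tendsto_zero_powrD:
  fixes f :: "'b \<Rightarrow> real"
  assumes "0 < p" "\<And>k. 0 \<le> f k" "((\<lambda>k. f k powr p) \<longlongrightarrow> 0) F"
  shows "(f \<longlongrightarrow> 0) F"
proof -
  have "((\<lambda>k. (f k powr p) powr (1 / p)) \<longlongrightarrow> 0 powr (1 / p)) F"
    using assms by (intro tendsto_powr2 tendsto_const) auto
  then show ?thesis
    using assms(1,2) by (simp add: powr_powr)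
qed

theorem theorem7:
  fixes G D :: "'a set" and d :: "'a \<Rightarrow> 'a \<Rightarrow> real" and p c :: real
    and T :: "'a \<Rightarrow> 'a" and x :: "nat \<Rightarrow> 'a"
  assumes "1 < p"
    and "p_uniformly_convex G d p c"
    and "D \<subseteq> G"
    and "T ` G \<subseteq> G"
    and "Fix G T \<inter> D \<noteq> {}"
    and "T ` D \<subseteq> D"
    and "\<forall>y \<in> Fix G T \<inter> D. pointwise_firmly_nonexpansive d p c T D y"
    and "x 0 \<in> D"
    and "\<forall>k. x (Suc k) = T (x k)"
  shows "(\<lambda>k. d (x k) (x (Suc k))) \<longlonglongrightarrow> 0"
proof -
  have c: "0 < c" and G: "Metric_space G d"
    using assms(2) unfolding p_uniformly_convex_def geodesic_space_def by blast+
  have nonneg: "0 \<le> d u v" for u v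
    using G by (rule Metric_space.nonneg)
  obtain y where y: "y \<in> Fix G T \<inter> D"
    using assms(5) by blast
  then have yG: "y \<in> G" and Ty: "T y = y"
    by (auto simp: Fix_def)
  obtain \<alpha> where \<alpha>: "0 < \<alpha>" "\<alpha> < 1"
    and fne: "\<And>u. u \<in> D \<Longrightarrow>
      d (T u) (T y) powr p \<le> d u y powr p - (1 - \<alpha>) / \<alpha> * psi d p c T u y"
    using assms(7) y unfolding pointwise_firmly_nonexpansive_def by blast
  have xD: "x k \<in> D" for k
    using assms(6,8,9) by (induction k) auto
  \<comment> \<open>The firm nonexpansiveness coefficient times the factor \<open>c / 2\<close> left
    over from \<open>psi\<close>. Both belong to the one chosen fixed point \<open>y\<close>, so
    \<open>K\<close> is the same for all \<open>k\<close>.\<close>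
  define K where "K = (1 - \<alpha>) / \<alpha> * (c / 2)"
  have "0 < K"
    using \<alpha> c by (simp add: K_def)
  have "K * d (x k) (x (Suc k)) powr p \<le> d (x k) y powr p - d (x (Suc k)) y powr p" for k
    \<comment> \<open>\<open>psi\<close> produces \<open>d (T u) u\<close>, the goal has
      \<open>d u (T u)\<close>; instantiating symmetry at this pair leaves the distances to
      \<open>y\<close> as they are.\<close>
    using fne[OF xD[of k]]
    unfolding psi_fixed_point[where T = T, OF G yG Ty] Ty K_def assms(9)[rule_format]
      Metric_space.commute[OF G, of "x k" "T (x k)"]
    by simp
  then have "(\<lambda>k. d (x k) (x (Suc k)) powr p) \<longlonglongrightarrow> 0"
    by (intro tendsto_zero_if_bounded_by_decrement[OF \<open>0 < K\<close>, where a = "\<lambda>k. d (x k) y powr p"])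
      simp_all
  from tendsto_zero_powrD[OF _ nonneg this] show ?thesis
    using assms(1) by simp
qed

end
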